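(* Consider an uncertain optimization problem $(\mathrm{P}(\xi),\ \xi\in\mathcal{U})$ with quasiconvex objective function $f(\cdot,\xi)$ and quasiconvex constraints $F(\cdot,\xi)$ (i.e. each component is quasiconvex) for any fixed $\xi\in\mathcal{U}$. Let $\mathcal{X}\subseteq\mathbb{R}^n$ be convex, let $\mathcal{U}$ be a finite set and let the metric $d$ be convex. Then, for every $\varepsilon\in\mathbb{R}$, the problem $(\mathrm{Rec}(\varepsilon))$, that is, the minimization of $x\mapsto r_\varepsilon(x,\mathcal{U})$ over $x\in\mathcal{X}$, is a convex optimization problem (minimization of a convex function over a convex set).
   Context: Uncertain problem: $\mathcal{X}\subseteq\mathbb{R}^n$ is closed, $\mathcal{U}\subseteq\mathbb{R}^M$ is a closed set with at least two elements, and for each $\xi\in\mathcal{U}$ the functions $F(\cdot,\xi):\mathbb{R}^n\to\mathbb{R}^m$ and $f(\cdot,\xi):\mathbb{R}^n\to\mathbb{R}$ are continuous. $\mathrm{P}(\xi)$ is the problem: minimize $f(x,\xi)$ subject to $F(x,\xi)\le 0$ (componentwise), $x\in\mathcal{X}$. Further, $d:\mathbb{R}^n\times\mathbb{R}^n\to\mathbb{R}$ is a metric; "$d$ convex" means convex as a function on $\mathbb{R}^n\times\mathbb{R}^n$ (e.g. $d(x,y)=\|y-x\|$ for a norm). For $\varepsilon\in\mathbb{R}$, $(\mathrm{Rec}(\varepsilon))$ is: minimize $\sup_{\xi\in\mathcal{U}} d(x,y(\xi))$ subject to $f(y(\xi),\xi)\le\varepsilon$ and $F(y(\xi),\xi)\le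 0$ for all $\xi\in\mathcal{U}$, $x\in\mathcal{X}$, $y:\mathcal{U}\to\mathcal{X}$. Let $\mathcal{G}_\varepsilon(\xi)=\{y\in\mathcal{X}: F(y,\xi)\le 0,\ f(y,\xi)\le\varepsilon\}$, $d(x,\mathcal{G}_\varepsilon(\xi))=\min_{y\in\mathcal{G}_\varepsilon(\xi)}d(x,y)$ with $d(x,\emptyset):=\infty$, and $r_\varepsilon(x,\mathcal{U})=\sup_{\xi\in\mathcal{U}}d(x,\mathcal{G}_\varepsilon(\xi))$ (values in $[0,+\infty]$). Then $(\mathrm{Rec}(\varepsilon))$ is equivalently written as $\min_{x\in\mathcal{X}} r_\varepsilon(x,\mathcal{U})$. *)

theory Defs
  imports "HOL-Analysis.Analysis"
begin

definition quasiconvex_on :: "'a::real_vector set \<Rightarrow> ('a \<Rightarrow> real) \<Rightarrow> bool" where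
  "quasiconvex_on S g \<longleftrightarrow> convex S \<and>
    (\<forall>x\<in>S. \<forall>y\<in>S. \<forall>u\<ge>0. \<forall>v\<ge>0. u + v = 1 \<longrightarrow>
      g (u *\<^sub>R x + v *\<^sub>R y) \<le> max (g x) (g y))"

(* The library's convex_on is for real-valued functions only.  The weights are strictly
   positive so that the product of a zero weight with an infinite value never occurs. *)
definition ereal_convex_on :: "'a::real_vector set \<Rightarrow> ('a \<Rightarrow> ereal) \<Rightarrow> bool" where
  "ereal_convex_on S g \<longleftrightarrow> convex S \<and>
    (\<forall>x\<in>S. \<forall>y\<in>S. \<forall>u>0. \<forall>v>0. u + v = 1 \<longrightarrow>
      g (u *\<^sub>R x + v *\<^sub>R y) \<le> ereal u * g x + ereal v * g y)"

(* "Minimize g over S", where the objective g is defined on the whole space. *)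
definition convex_optimization_problem :: "'a::real_vector set \<Rightarrow> ('a \<Rightarrow> ereal) \<Rightarrow> bool" where
  "convex_optimization_problem S g \<longleftrightarrow> convex S \<and> ereal_convex_on UNIV g"

(* The order on real ^ 'm is componentwise. *)
definition level_feasible_set ::
  "(real ^ 'n) set \<Rightarrow> (real ^ 'n \<Rightarrow> 'u \<Rightarrow> real ^ 'm) \<Rightarrow> (real ^ 'n \<Rightarrow> 'u \<Rightarrow> real) \<Rightarrow>
   real \<Rightarrow> 'u \<Rightarrow> (real ^ 'n) set" where
  "level_feasible_set X F f \<epsilon> \<xi> = {y \<in> X. F y \<xi> \<le> 0 \<and> f y \<xi> \<le> \<epsilon>}"

(* The infimum over the empty set is infinity. *)
definition dist_to_set :: "('a \<Rightarrow> 'a \<Rightarrow> real) \<Rightarrow> 'a \<Rightarrow> 'a set \<Rightarrow> ereal" where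
  "dist_to_set d x G = (INF y\<in>G. ereal (d x y))"

definition recovery_radius ::
  "(real ^ 'n \<Rightarrow> real ^ 'n \<Rightarrow> real) \<Rightarrow> (real ^ 'n) set \<Rightarrow>
   (real ^ 'n \<Rightarrow> 'u \<Rightarrow> real ^ 'm) \<Rightarrow> (real ^ 'n \<Rightarrow> 'u \<Rightarrow> real) \<Rightarrow>
   real \<Rightarrow> 'u set \<Rightarrow> real ^ 'n \<Rightarrow> ereal" where
  "recovery_radius d X F f \<epsilon> U x = (SUP \<xi>\<in>U. dist_to_set d x (level_feasible_set X F f \<epsilon> \<xi>))"

end

theory Submission
  imports Defs
begin

text \<open>
  The quasiconvexity assumptions make every level-feasible set convex. The distance to a convex
  set is convex because \<^term>\<open>d\<close> is jointly convex: mixing near-minimisers for two points gives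
  a competitor for the mixed point. A supremum of convex functions is convex.
\<close>

text \<open>If both values are at most \<open>c\<close>, so is their maximum, which bounds
  \<open>g\<close> on the segment.\<close>

lemma quasiconvex_sublevel_convex:
  assumes "quasiconvex_on S g"
  shows "convex {x \<in> S. g x \<le> c}"
proof (rule convexI)
  fix x y :: 'a and u v :: real
  assume *: "x \<in> {x \<in> S. g x \<le> c}" "y \<in> {x \<in> S. g x \<le> c}" "0 \<le> u" "0 \<le> v" "u + v = 1"
  then have "u *\<^sub>R x + v *\<^sub>R y \<in> S"
    using assms by (auto simp: quasiconvex_on_def convex_def)
  moreover have "g (u *\<^sub>R x + v *\<^sub>R y) \<le> max (g x) (g y)"
    using assms * by (simp add: quasiconvex_on_def)
  ultimately show "u *\<^sub>R x + v *\<^sub>R y \<in> {x \<in> S. g x \<le> c}"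
    using * by auto
qed

lemma level_feasible_set_convex:
  assumes "convex X" "quasiconvex_on UNIV (\<lambda>x. f x \<xi>)"
    and "\<And>i. quasiconvex_on UNIV (\<lambda>x. F x \<xi> $ i)"
  shows "convex (level_feasible_set X F f \<epsilon> \<xi>)"
proof -
  \<comment> \<open>The order on vectors is componentwise, so each component of \<open>F\<close>
    gives its own sublevel set. Membership in \<open>UNIV\<close> is spelled out to match the
    sublevel lemma with \<open>S = UNIV\<close>.\<close>
  have "level_feasible_set X F f \<epsilon> \<xi> =
      X \<inter> {x \<in> UNIV. f x \<xi> \<le> \<epsilon>} \<inter> (\<Inter>i. {x \<in> UNIV. F x \<xi> $ i \<le> 0})"
    by (auto simp: level_feasible_set_def less_eq_vec_def)
  then show ?thesis
    using assms by (simp only:) (intro convex_Int convex_INT quasiconvex_sublevel_convex)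
qed

text \<open>No minimiser has to exist: the bound is shown for every pair of points of
  \<open>G\<close>, and infima are taken afterwards. Nonnegativity of \<open>d\<close> keeps all
  terms away from minus infinity, so that infima can be moved through sums in
  \<open>ereal\<close>.\<close>

lemma ereal_convex_on_dist_to_set:
  assumes conv: "convex_on UNIV (\<lambda>(x, y). d x y)" and "convex G"
    and nonneg: "\<And>x y. 0 \<le> d x y"
  shows "ereal_convex_on UNIV (\<lambda>x. dist_to_set d x G)"
  unfolding ereal_convex_on_def
proof (intro conjI ballI allI impI)
  fix x y :: 'a and u v :: real
  assume uv: "0 < u" "0 < v" "u + v = 1"
  let ?z = "u *\<^sub>R x + v *\<^sub>R y"
  show "dist_to_set d ?z G \<le> ereal u * dist_to_set d x G + ereal v * dist_to_set d y G"
  proof (cases "G = {}")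
    \<comment> \<open>The infimum over the empty set is infinity, and positive weights keep the
      right-hand side infinite.\<close>
    case True
    then show ?thesis using uv by (simp add: dist_to_set_def top_ereal_def)
  next
    case False
    have *: "dist_to_set d ?z G \<le> ereal u * ereal (d x p) + ereal v * ereal (d y q)"
      if "p \<in> G" "q \<in> G" for p q
    proof -
      have "u *\<^sub>R p + v *\<^sub>R q \<in> G"
        using \<open>convex G\<close> that uv by (auto simp: convex_def)
      then have "dist_to_set d ?z G \<le> ereal (d ?z (u *\<^sub>R p + v *\<^sub>R q))"
        unfolding dist_to_set_def by (rule INF_lower)
      \<comment> \<open>Joint convexity at the pairs \<open>(x, p)\<close> and
        \<open>(y, q)\<close>, whose mixture is \<open>?z\<close> paired with the mixed point of
        \<open>G\<close>.\<close>
      also have "d ?z (u *\<^sub>R p + v *\<^sub>R q) \<le> u * d x p + v * d y q"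
        using conv uv unfolding convex_on_def
        by (auto dest!: bspec[of _ _ "(x, p)"] bspec[of _ _ "(y, q)"] spec[of _ u] spec[of _ v])
      finally show ?thesis by simp
    qed
    have cmult: "ereal c * dist_to_set d w G = (INF p\<in>G. ereal c * ereal (d w p))"
      if "0 < c" for c w
    proof -
      \<comment> \<open>The set comprehension is the form in which \<open>ereal_Inf_cmult\<close> is
        stated; it is then turned back into an image.\<close>
      have "ereal c * dist_to_set d w G = Inf {ereal c * t |t. t \<in> (\<lambda>p. ereal (d w p)) ` G}"
        using ereal_Inf_cmult[OF that] by (simp add: dist_to_set_def)
      also have "{ereal c * t |t. t \<in> (\<lambda>p. ereal (d w p)) ` G} = (\<lambda>p. ereal c * ereal (d w p)) ` G"
        by blast
      finally show ?thesis .
    qed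
    have nonneg': "0 \<le> ereal c * dist_to_set d w G" if "0 < c" for c w
      using that nonneg by (simp add: dist_to_set_def INF_greatest ereal_zero_le_0_iff)
    \<comment> \<open>The points \<open>p\<close> and \<open>q\<close> vary independently, so the
      double infimum splits: first over \<open>q\<close> with the \<open>p\<close> term constant,
      then over \<open>p\<close> with the distance from \<open>y\<close> constant. That second
      constant may not be minus infinity, which \<open>nonneg'\<close> ensures.\<close>
    have "dist_to_set d ?z G \<le> (INF p\<in>G. INF q\<in>G. ereal u * ereal (d x p) + ereal v * ereal (d y q))"
      by (intro INF_greatest *)
    also have "\<dots> = (INF p\<in>G. ereal u * ereal (d x p) + ereal v * dist_to_set d y G)"
      unfolding cmult[OF uv(2)]
      using False nonneg uv by (intro INF_cong refl INF_ereal_add_right) auto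
    also have "\<dots> = ereal u * dist_to_set d x G + ereal v * dist_to_set d y G"
      unfolding cmult[OF uv(1)]
      using False nonneg uv nonneg'[OF uv(2), of y] by (intro INF_ereal_add_left) auto
    finally show ?thesis .
  qed
qed simp

text \<open>Each member obeys its own convexity inequality, whose right-hand side only grows when
  members are replaced by suprema; this bound does not depend on \<open>i\<close>.\<close>

lemma ereal_convex_on_SUP:
  assumes "convex S" "\<And>i. i \<in> I \<Longrightarrow> ereal_convex_on S (g i)"
  shows "ereal_convex_on S (\<lambda>x. SUP i\<in>I. g i x)"
  unfolding ereal_convex_on_def
proof (intro conjI ballI allI impI SUP_least)
  fix x y :: 'a and u v :: real and i
  assume *: "x \<in> S" "y \<in> S" "0 < u" "0 < v" "u + v = 1" "i \<in> I"
  then have "g i (u *\<^sub>R x + v *\<^sub>R y) \<le> ereal u * g i x + ereal v * g i y"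
    using assms(2) by (auto simp: ereal_convex_on_def)
  also have "\<dots> \<le> ereal u * (SUP i\<in>I. g i x) + ereal v * (SUP i\<in>I. g i y)"
    using * by (intro add_mono ereal_mult_left_mono SUP_upper) auto
  finally show "g i (u *\<^sub>R x + v *\<^sub>R y) \<le> \<dots>" .
qed (rule assms(1))

theorem lemma5:
  fixes X :: "(real ^ 'n) set"
    and U :: "(real ^ 'k) set"
    and F :: "real ^ 'n \<Rightarrow> real ^ 'k \<Rightarrow> real ^ 'm"
    and f :: "real ^ 'n \<Rightarrow> real ^ 'k \<Rightarrow> real"
    and d :: "real ^ 'n \<Rightarrow> real ^ 'n \<Rightarrow> real"
    and \<epsilon> :: real
  assumes "closed X"
    and "closed U"
    and "\<exists>\<xi>\<in>U. \<exists>\<xi>'\<in>U. \<xi> \<noteq> \<xi>'"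
    and "\<And>\<xi>. \<xi> \<in> U \<Longrightarrow> continuous_on UNIV (\<lambda>x. F x \<xi>)"
    and "\<And>\<xi>. \<xi> \<in> U \<Longrightarrow> continuous_on UNIV (\<lambda>x. f x \<xi>)"
    and "Metric_space UNIV d"
    and "\<And>\<xi>. \<xi> \<in> U \<Longrightarrow> quasiconvex_on UNIV (\<lambda>x. f x \<xi>)"
    and "\<And>\<xi> i. \<xi> \<in> U \<Longrightarrow> quasiconvex_on UNIV (\<lambda>x. F x \<xi> $ i)"
    and "convex X"
    and "finite U"
    and "convex_on UNIV (\<lambda>(x, y). d x y)"
  shows "convex_optimization_problem X (recovery_radius d X F f \<epsilon> U)"
  unfolding convex_optimization_problem_def recovery_radius_def
  \<comment> \<open>The radius is a supremum over \<open>U\<close> of distances to level-feasible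
    sets, so the three convexity lemmas chain together; the metric supplies nonnegativity.\<close>
  using assms(7-9,11) Metric_space.nonneg[OF assms(6)]
  by (intro conjI ereal_convex_on_SUP ereal_convex_on_dist_to_set level_feasible_set_convex) auto

end
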